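(* Let $S, T \subset \mathbb{R}^n$ be such that $T$ is discrete and $S$ is finite. Suppose that $B\subset\mathbb{R}^n$ is a closed Euclidean ball such that $S \subseteq B$ and $(T\setminus S)\cap \operatorname{int} B = \emptyset$. Let $$C := \operatorname{co}(S\cap \partial B)\cap \operatorname{co}((T\setminus S)\cap \partial B),$$ and, when $C\neq\emptyset$, let $F_S$ and $F_T$ be the minimal faces of the convex sets $\operatorname{co}(S\cap \partial B)$ and $\operatorname{co}((T\setminus S)\cap \partial B)$, respectively, that contain $C$. Then $$\dim V_T(S) = \begin{cases} n, & \text{if } C = \emptyset,\\ n - \dim \operatorname{co}(F_S\cup F_T), & \text{if } C\neq \emptyset.\end{cases}$$
   Context: For $S,T\subseteq\mathbb{R}^n$ (here $S$ need not be a subset of $T$) the Voronoi cell of $S$ with respect to $T$ is $$V_T(S) := \left\{x\in\mathbb{R}^n : \sup_{s\in S}\|x-s\| \le \inf_{t\in T\setminus S}\|x-t\|\right\},$$ where $\|\cdot\|$ is the Euclidean norm; equivalently, $x\in V_T(S)$ iff $\|x-s\|\le\|x-t\|$ for all $s\in S$, $t\in T\setminus S$ (with $\inf\emptyset=+\infty$). This is a convex set. A set $T\subset\mathbb{R}^n$ is called discrete if every bounded subset of $\mathbb{R}^n$ contains only finitely many points of $T$. $\operatorname{co}$ denotes convex hull, $\operatorname{int}$ interior, $\partial$ topological boundary. The dimension $\dim$ of a nonempty convex set is the dimension of its affine hull. A face of a convex set $P$ is a convex subset $F\subseteq P$ such that whenever $x,y\in P$ and some point of the open segment $(x,y)$ lies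 in $F$, then $x,y\in F$; the minimal face of $P$ containing a nonempty set $C\subseteq P$ is the intersection of all faces of $P$ containing $C$. *)

theory Defs
  imports "HOL-Analysis.Analysis"
begin

text \<open>The supremum and infimum are taken in the extended reals, so that the infimum over the
  empty set is \<open>\<infinity>\<close> and the supremum over the empty set is \<open>-\<infinity>\<close>.\<close>

definition voronoi_cell :: "'a::euclidean_space set \<Rightarrow> 'a set \<Rightarrow> 'a set" where
  "voronoi_cell T S =
     {x. (SUP s\<in>S. ereal (norm (x - s))) \<le> (INF t\<in>T - S. ereal (norm (x - t)))}"

lemma mem_voronoi_cell_iff:
  "x \<in> voronoi_cell T S \<longleftrightarrow> (\<forall>s\<in>S. \<forall>t\<in>T - S. norm (x - s) \<le> norm (x - t))"
  unfolding voronoi_cell_def by (auto simp: SUP_le_iff le_INF_iff)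

text \<open>This is stronger than \<^const>\<open>discrete\<close> of the library, which allows accumulation points
  outside the set.\<close>

definition discrete_set :: "'a::euclidean_space set \<Rightarrow> bool" where
  "discrete_set T \<longleftrightarrow> (\<forall>A. bounded A \<longrightarrow> finite (T \<inter> A))"

definition minimal_face :: "'a::euclidean_space set \<Rightarrow> 'a set \<Rightarrow> 'a set" where
  "minimal_face P C = \<Inter>{F. F face_of P \<and> C \<subseteq> F}"

end

theory Submission
  imports Defs
begin

text \<open>
  Let \<open>z\<close> be the centre of the ball, \<open>A\<close> and \<open>B\<close> the points of \<open>S\<close> and of \<open>T - S\<close> on the bounding
  sphere. For \<open>s\<close>, \<open>t\<close> on the sphere, \<open>norm (x - s) \<le> norm (x - t)\<close> says that \<open>x - z\<close> makes a
  nonnegative inner product with \<open>s - t\<close>; every other pair satisfies a strict inequality at \<open>z\<close> and, since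
  only finitely many points of \<open>T\<close> are near the ball, imposes no condition close to \<open>z\<close>. Hence the
  cell agrees near \<open>z\<close> with the translate by \<open>z\<close> of the polyhedral cone of all \<open>u\<close> such that
  \<open>u \<bullet> d \<ge> 0\<close> for every \<open>d\<close> in \<open>D = {a - b | a \<in> A, b \<in> B}\<close>, and the two convex sets have the same
  dimension (lemma \<open>aff_dim_voronoi_cell\<close>).

  The dimension of a cone cut out by finitely many linear inequalities is \<open>n\<close> minus the rank of its
  implicit equalities (lemma \<open>aff_dim_polyhedral_cone\<close>), so it remains to recognise these. If \<open>u\<close> is
  in the cone, then \<open>u\<close> weakly separates the hulls of \<open>A\<close> and \<open>B\<close>, so it is constant on \<open>C\<close> and on
  the minimal faces around it, because the level set of \<open>u\<close> through \<open>C\<close> cuts out a face of either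
  hull (lemma \<open>separating_functional_constant_on_minimal_faces\<close>). Conversely the cone has an element
  that vanishes on \<open>a - b\<close> only if both \<open>a\<close> and \<open>b\<close> lie in these faces: it is chosen to expose the
  minimal face of the convex hull of \<open>D\<close> at the origin, or to separate the hull strictly from the
  origin if \<open>C\<close> is empty (lemma \<open>hulls_separating_functional\<close>). Thus the implicit
  equalities are the differences \<open>a - b\<close> of vertices of the two faces. Their span is the direction
  space of the affine hull of the union of the faces. If \<open>C\<close> is empty there are none, and the cone
  is full-dimensional.
\<close>

section \<open>Minimal faces\<close>

lemma subset_minimal_face: "C \<subseteq> minimal_face P C"
  by (auto simp: minimal_face_def)

lemma minimal_face_subset_face: "\<lbrakk>F face_of P; C \<subseteq> F\<rbrakk> \<Longrightarrow> minimal_face P C \<subseteq> F"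
  by (auto simp: minimal_face_def)

lemma minimal_face_face_of:
  assumes "convex P" "C \<subseteq> P"
  shows "minimal_face P C face_of P"
  unfolding minimal_face_def
  by (rule face_of_Inter) (use assms face_of_refl in auto)

text \<open>A point on the relative frontier of a polyhedral face lies in one of its facets, which is a
  smaller face of the whole polyhedron.\<close>

lemma rel_interior_minimal_face:
  fixes P :: "'a::euclidean_space set"
  assumes P: "polyhedron P" and x: "x \<in> P"
  shows "x \<in> rel_interior (minimal_face P {x})"
proof (rule ccontr)
  let ?F = "minimal_face P {x}"
  assume n: "x \<notin> rel_interior ?F"
  have F: "?F face_of P"
    using minimal_face_face_of P x polyhedron_imp_convex by (metis empty_subsetI insert_subset)
  then have polyF: "polyhedron ?F"
    using P face_of_polyhedron_polyhedron by blast
  have "x \<in> ?F"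
    using subset_minimal_face[of "{x}" P] by auto
  then have "x \<in> rel_frontier ?F"
    using n polyF by (simp add: rel_frontier_def closure_closed polyhedron_imp_closed)
  then obtain G where G: "G facet_of ?F" "x \<in> G"
    using rel_frontier_of_polyhedron[OF polyF] by auto
  then have "G face_of ?F"
    by (simp add: facet_of_def)
  then have "?F \<subseteq> G"
    using minimal_face_subset_face face_of_trans F G(2) by (metis empty_subsetI insert_subset)
  then have "G = ?F"
    using \<open>G face_of ?F\<close> face_of_imp_subset by auto
  then show False
    using G(1) by (simp add: facet_of_def)
qed

lemma face_of_finite_convex_hull:
  fixes A :: "'a::euclidean_space set"
  assumes "finite A" and F: "F face_of convex hull A"
  shows "F = convex hull (A \<inter> F)"
proof
  obtain A' where A': "A' \<subseteq> A" "F = convex hull A'"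
    using face_of_convex_hull_subset assms finite_imp_compact by metis
  then have "A' \<subseteq> A \<inter> F"
    by (auto intro: hull_inc)
  then show "F \<subseteq> convex hull (A \<inter> F)"
    using A'(2) hull_mono by metis
  show "convex hull (A \<inter> F) \<subseteq> F"
    using F by (meson Int_lower2 face_of_imp_convex hull_minimal)
qed

section \<open>Cones given by finitely many linear inequalities\<close>

text \<open>If the origin is outside the convex hull, a strictly separating functional vanishes nowhere on
  \<open>D\<close>. Otherwise the witness exposes the minimal face of the hull at the origin: the origin is a
  relative interior point of that face, so the segment to it from any \<open>d\<close> in the face can be
  prolonged inside the face.\<close>

lemma nonnegative_functional_on_finite:
  fixes D :: "'a::euclidean_space set"
  assumes "finite D"
  obtains u where "\<And>d. d \<in> D \<Longrightarrow> 0 \<le> u \<bullet> d"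
    and "\<And>d. \<lbrakk>d \<in> D; u \<bullet> d = 0\<rbrakk> \<Longrightarrow> \<exists>e>0. - (e *\<^sub>R d) \<in> convex hull D"
proof (cases "0 \<in> convex hull D")
  case False
  have "closed (convex hull D)"
    using assms by (simp add: compact_imp_closed finite_imp_compact_convex_hull)
  then obtain a b where "0 < b" "\<forall>x\<in>convex hull D. a \<bullet> x > b"
    using False separating_hyperplane_closed_0[of "convex hull D"] by auto
  then have pos: "0 < a \<bullet> d" if "d \<in> D" for d
    using that hull_inc[of d D convex] by fastforce
  show ?thesis
    by (rule that[of a]) (use pos in fastforce)+
next
  case True
  let ?Q = "convex hull D" and ?F = "minimal_face (convex hull D) {0}"
  have poly: "polyhedron ?Q"
    using assms by (rule polyhedron_convex_hull)
  have F: "?F face_of ?Q"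
    using True by (intro minimal_face_face_of) auto
  then obtain a b where ab: "?Q \<subseteq> {x. a \<bullet> x \<le> b}" "?F = ?Q \<inter> {x. a \<bullet> x = b}"
    using exposed_face_of_polyhedron[OF poly, of ?F] unfolding exposed_face_of_def by blast
  have "0 \<in> ?F"
    using subset_minimal_face[of "{0}" ?Q] by auto
  then have "b = 0"
    using ab(2) by auto
  show ?thesis
  proof (rule that[of "- a"])
    show "0 \<le> - a \<bullet> d" if "d \<in> D" for d
      using ab(1) \<open>b = 0\<close> hull_inc[OF that, of convex] by auto
  next
    fix d assume d: "d \<in> D" "- a \<bullet> d = 0"
    then have "d \<in> ?F"
      using ab(2) \<open>b = 0\<close> hull_inc[OF d(1), of convex] by auto
    moreover have "0 \<in> rel_interior ?F"
      by (rule rel_interior_minimal_face[OF poly True])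
    ultimately obtain e where "e > 1" "(1 - e) *\<^sub>R d + e *\<^sub>R 0 \<in> ?F"
      using convex_rel_interior_if2[OF face_of_imp_convex[OF F]] by (meson hull_inc)
    moreover from this have "- ((e - 1) *\<^sub>R d) \<in> ?Q"
      using F face_of_imp_subset by (fastforce simp: algebra_simps)
    ultimately show "\<exists>e>0. - (e *\<^sub>R d) \<in> ?Q"
      by (intro exI[of _ "e - 1"]) auto
  qed
qed

text \<open>Intersecting the cone with the open set on which the remaining inequalities are strict leaves
  an open piece of the orthogonal complement of \<open>E\<close>; the point \<open>u\<close> shows that it is nonempty.\<close>

lemma aff_dim_polyhedral_cone:
  fixes D E :: "'a::euclidean_space set"
  assumes "finite D" "E \<subseteq> D"
    and zero: "\<And>v d. \<lbrakk>\<forall>d\<in>D. 0 \<le> v \<bullet> d; d \<in> E\<rbrakk> \<Longrightarrow> v \<bullet> d = 0"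
    and u: "\<And>d. d \<in> D \<Longrightarrow> 0 \<le> u \<bullet> d" "\<And>d. d \<in> D - E \<Longrightarrow> 0 < u \<bullet> d"
  shows "aff_dim {v. \<forall>d\<in>D. 0 \<le> v \<bullet> d} = int DIM('a) - int (dim E)"
proof -
  define K where "K = {v. \<forall>d\<in>D. 0 \<le> v \<bullet> d}"
  define O' where "O' = (\<Inter>d\<in>D - E. {v. 0 < d \<bullet> v})"
  define L where "L = {y \<in> UNIV. \<forall>x\<in>span E. orthogonal x y}"
  have L: "v \<in> L \<longleftrightarrow> (\<forall>d\<in>E. v \<bullet> d = 0)" for v
  proof
    assume "\<forall>d\<in>E. v \<bullet> d = 0"
    then have "orthogonal v x" if "x \<in> span E" for x
      using orthogonal_to_span[OF that] by (auto simp: orthogonal_def)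
    then show "v \<in> L"
      by (auto simp: L_def orthogonal_commute)
  qed (auto simp: L_def orthogonal_def span_base inner_commute)
  have "open O'"
    unfolding O'_def using assms(1) by (intro open_INT) (auto simp: open_halfspace_gt)
  have "convex K"
    unfolding K_def by (auto simp: convex_def inner_add_left)
  have "subspace L"
    by (auto simp: subspace_def L inner_add_left)
  have "K \<inter> O' = L \<inter> O'"
  proof
    show "K \<inter> O' \<subseteq> L \<inter> O'"
      using zero by (auto simp: K_def L)
    show "L \<inter> O' \<subseteq> K \<inter> O'"
    proof
      fix v assume "v \<in> L \<inter> O'"
      then have "0 \<le> v \<bullet> d" if "d \<in> D" for d
        using that by (cases "d \<in> E") (auto simp: L O'_def inner_commute less_imp_le)
      then show "v \<in> K \<inter> O'"
        using \<open>v \<in> L \<inter> O'\<close> by (auto simp: K_def)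
    qed
  qed
  moreover have "u \<in> K \<inter> O'"
    using u by (auto simp: K_def O'_def inner_commute)
  ultimately have "aff_dim K = aff_dim L"
    using aff_dim_convex_Int_open[OF \<open>convex K\<close> \<open>open O'\<close>]
      aff_dim_convex_Int_open[OF subspace_imp_convex[OF \<open>subspace L\<close>] \<open>open O'\<close>]
    by (metis empty_iff)
  also have "\<dots> = int (dim L)"
    by (rule aff_dim_subspace) fact
  also have "dim L + dim E = DIM('a)"
    using dim_subspace_orthogonal_to_vectors[of "span E" UNIV] by (simp add: L_def)
  then have "int (dim L) = int DIM('a) - int (dim E)"
    by simp
  finally show ?thesis
    by (simp add: K_def)
qed

section \<open>Functionals separating the convex hulls of two finite sets\<close>

text \<open>A functional separating the hulls takes a single value \<open>u \<bullet> c\<close> on the common points. The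
  points of either hull where that value is attained form a face.\<close>

lemma separating_functional_constant_on_minimal_faces:
  fixes A B :: "'a::euclidean_space set"
  defines "C \<equiv> convex hull A \<inter> convex hull B"
  assumes sep: "\<And>a b. \<lbrakk>a \<in> A; b \<in> B\<rbrakk> \<Longrightarrow> u \<bullet> b \<le> u \<bullet> a"
    and "C \<noteq> {}"
    and f: "f \<in> minimal_face (convex hull A) C" and g: "g \<in> minimal_face (convex hull B) C"
  shows "u \<bullet> f = u \<bullet> g"
proof -
  obtain c where c: "c \<in> C"
    using \<open>C \<noteq> {}\<close> by auto
  have 1: "u \<bullet> b \<le> u \<bullet> p" if "p \<in> convex hull A" "b \<in> B" for p b
  proof -
    have "convex hull A \<subseteq> {x. u \<bullet> b \<le> u \<bullet> x}"
      using sep that(2) convex_halfspace_ge by (intro hull_minimal) auto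
    then show ?thesis
      using that(1) by auto
  qed
  have sep_hull: "u \<bullet> q \<le> u \<bullet> p" if "p \<in> convex hull A" "q \<in> convex hull B" for p q
  proof -
    have "convex hull B \<subseteq> {x. u \<bullet> x \<le> u \<bullet> p}"
      using 1 that(1) by (intro hull_minimal convex_halfspace_le) auto
    then show ?thesis
      using that(2) by auto
  qed
  have const: "u \<bullet> c' = u \<bullet> c" if "c' \<in> C" for c'
    using sep_hull[of c c'] sep_hull[of c' c] that c by (auto simp: C_def)
  have "convex hull A \<inter> {x. u \<bullet> x = u \<bullet> c} face_of convex hull A"
    using sep_hull c by (intro face_of_Int_supporting_hyperplane_ge) (auto simp: C_def)
  then have "u \<bullet> f = u \<bullet> c"
    using minimal_face_subset_face[of _ "convex hull A" C] const f by (force simp: C_def)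
  have "convex hull B \<inter> {x. u \<bullet> x = u \<bullet> c} face_of convex hull B"
    using sep_hull c by (intro face_of_Int_supporting_hyperplane_le) (auto simp: C_def)
  then have "u \<bullet> g = u \<bullet> c"
    using minimal_face_subset_face[of _ "convex hull B" C] const g by (force simp: C_def)
  with \<open>u \<bullet> f = u \<bullet> c\<close> show ?thesis
    by simp
qed

lemma face_of_convex_combination:
  assumes F: "F face_of P" and "a \<in> P" "p \<in> P" "0 < e"
    and x: "(e / (1 + e)) *\<^sub>R a + (1 / (1 + e)) *\<^sub>R p \<in> F"
  shows "a \<in> F"
proof (cases "a = p")
  case True
  have "(e / (1 + e)) *\<^sub>R p + (1 / (1 + e)) *\<^sub>R p = ((e + 1) / (1 + e)) *\<^sub>R p"
    by (simp add: add_divide_distrib scaleR_left_distrib)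
  also have "\<dots> = p"
    using \<open>0 < e\<close> by (simp add: add.commute)
  finally show ?thesis
    using x True by metis
next
  case False
  have "1 - 1 / (1 + e) = e / (1 + e)"
    using \<open>0 < e\<close> by (simp add: field_simps)
  then have "(e / (1 + e)) *\<^sub>R a + (1 / (1 + e)) *\<^sub>R p \<in> open_segment a p"
    using \<open>0 < e\<close> False unfolding in_segment by (intro conjI exI[of _ "1 / (1 + e)"]) auto
  then show ?thesis
    using face_ofD[OF F _ \<open>a \<in> P\<close> \<open>p \<in> P\<close> x] by blast
qed

text \<open>Applied to the differences \<open>a - b\<close>, the functional above satisfies \<open>u \<bullet> a = u \<bullet> b\<close> only if some
  \<open>- e (a - b)\<close> has the form \<open>p - q\<close> with \<open>p\<close>, \<open>q\<close> in the two hulls. Then \<open>e a + p = e b + q\<close>, so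
  after normalisation a point of \<open>C\<close> lies on a segment issuing from \<open>a\<close>, and also on one issuing
  from \<open>b\<close>.\<close>

lemma hulls_separating_functional:
  fixes A B :: "'a::euclidean_space set"
  defines "C \<equiv> convex hull A \<inter> convex hull B"
  assumes "finite A" "finite B"
  obtains u where "\<And>a b. \<lbrakk>a \<in> A; b \<in> B\<rbrakk> \<Longrightarrow> u \<bullet> b \<le> u \<bullet> a"
    and "\<And>a b. \<lbrakk>a \<in> A; b \<in> B; u \<bullet> a = u \<bullet> b\<rbrakk> \<Longrightarrow>
      C \<noteq> {} \<and> a \<in> minimal_face (convex hull A) C \<and> b \<in> minimal_face (convex hull B) C"
proof -
  define D where "D = (\<lambda>(a, b). a - b) ` (A \<times> B)"
  have "finite D"
    using assms by (simp add: D_def)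
  then obtain u where u: "\<And>d. d \<in> D \<Longrightarrow> 0 \<le> u \<bullet> d"
    "\<And>d. \<lbrakk>d \<in> D; u \<bullet> d = 0\<rbrakk> \<Longrightarrow> \<exists>e>0. - (e *\<^sub>R d) \<in> convex hull D"
    using nonnegative_functional_on_finite by blast
  have hull_D: "convex hull D \<subseteq> (\<Union>x\<in>convex hull A. \<Union>y\<in>convex hull B. {x - y})"
    by (intro hull_minimal convex_differences) (auto simp: D_def intro!: hull_inc bexI)
  have FA: "minimal_face (convex hull A) C face_of convex hull A"
    and FB: "minimal_face (convex hull B) C face_of convex hull B"
    by (auto intro!: minimal_face_face_of simp: C_def)
  show ?thesis
  proof (rule that[of u])
    show "u \<bullet> b \<le> u \<bullet> a" if "a \<in> A" "b \<in> B" for a b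
      using u(1)[of "a - b"] that by (auto simp: D_def inner_diff_right)
  next
    fix a b assume ab: "a \<in> A" "b \<in> B" "u \<bullet> a = u \<bullet> b"
    then have "a - b \<in> D" "u \<bullet> (a - b) = 0"
      by (auto simp: D_def inner_diff_right)
    then obtain e where "0 < e" "- (e *\<^sub>R (a - b)) \<in> convex hull D"
      using u(2) by blast
    then obtain p q where pq: "p \<in> convex hull A" "q \<in> convex hull B"
      "- (e *\<^sub>R (a - b)) = p - q"
      using hull_D by blast
    have a: "a \<in> convex hull A" and b: "b \<in> convex hull B"
      using ab by (auto intro: hull_inc)
    define x where "x = (e / (1 + e)) *\<^sub>R a + (1 / (1 + e)) *\<^sub>R p"
    have "e *\<^sub>R a + p = e *\<^sub>R b + q"
      using pq(3) by (simp add: algebra_simps)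
    then have "(1 / (1 + e)) *\<^sub>R (e *\<^sub>R a + p) = (1 / (1 + e)) *\<^sub>R (e *\<^sub>R b + q)"
      by simp
    then have x': "x = (e / (1 + e)) *\<^sub>R b + (1 / (1 + e)) *\<^sub>R q"
      by (simp add: x_def scaleR_right_distrib)
    have sum1: "0 \<le> e / (1 + e)" "0 \<le> 1 / (1 + e)" "e / (1 + e) + 1 / (1 + e) = 1"
      using \<open>0 < e\<close> by (auto simp: field_simps)
    have "x \<in> convex hull A"
      unfolding x_def by (rule convexD[OF convex_convex_hull a pq(1) sum1])
    moreover have "x \<in> convex hull B"
      unfolding x' by (rule convexD[OF convex_convex_hull b pq(2) sum1])
    ultimately have "x \<in> C"
      by (simp add: C_def)
    then have "x \<in> minimal_face (convex hull A) C" "x \<in> minimal_face (convex hull B) C"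
      using subset_minimal_face by blast+
    then show "C \<noteq> {} \<and> a \<in> minimal_face (convex hull A) C \<and> b \<in> minimal_face (convex hull B) C"
      using face_of_convex_combination[OF FA a pq(1) \<open>0 < e\<close>]
        face_of_convex_combination[OF FB b pq(2) \<open>0 < e\<close>] \<open>x \<in> C\<close> x_def x' by auto
  qed
qed

text \<open>Differences within \<open>A\<close> are obtained from mixed ones by passing through a point of \<open>B\<close>,
  and conversely for differences within \<open>B\<close>.\<close>

lemma aff_dim_Un_eq_dim_differences:
  fixes A B :: "'a::euclidean_space set"
  assumes "A \<noteq> {}" "B \<noteq> {}"
  shows "aff_dim (A \<union> B) = int (dim ((\<lambda>(a, b). a - b) ` (A \<times> B)))" (is "_ = int (dim ?E)")
proof -
  obtain a0 b0 where ab: "a0 \<in> A" "b0 \<in> B"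
    using assms by auto
  let ?X = "(\<lambda>x. x - a0) ` (A \<union> B)"
  have E: "a - b \<in> span ?E" if "a \<in> A" "b \<in> B" for a b
    using that by (auto intro!: span_base)
  have X: "x - a0 \<in> span ?X" if "x \<in> A \<union> B" for x
    using that by (auto intro!: span_base)
  have "?X \<subseteq> span ?E"
  proof clarify
    fix x assume "x \<in> A \<union> B"
    then show "x - a0 \<in> span ?E"
    proof
      assume "x \<in> A"
      then show ?thesis
        using span_diff[OF E[of x b0] E[of a0 b0]] ab by simp
    next
      assume "x \<in> B"
      then show ?thesis
        using span_neg[OF E[of a0 x]] ab by simp
    qed
  qed
  moreover have "?E \<subseteq> span ?X"
  proof clarify
    fix a b assume "a \<in> A" "b \<in> B"
    then show "a - b \<in> span ?X"
      using span_diff[OF X[of a] X[of b]] by simp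
  qed
  ultimately have "dim ?X = dim ?E"
    by (metis dim_span span_eq)
  moreover have "a0 \<in> affine hull (A \<union> B)"
    using ab by (auto intro: hull_inc)
  ultimately show ?thesis
    using aff_dim_eq_dim_subtract by metis
qed

section \<open>The Voronoi cell near the centre of the ball\<close>

lemma norm_le_iff_inner_of_equidistant:
  fixes x z s t :: "'a::euclidean_space"
  assumes "dist z s = dist z t"
  shows "norm (x - s) \<le> norm (x - t) \<longleftrightarrow> 0 \<le> (x - z) \<bullet> (s - t)"
proof -
  have "(z - s) \<bullet> (z - s) = (z - t) \<bullet> (z - t)"
    using assms by (metis dist_norm dot_square_norm)
  then have "(x - s) \<bullet> (x - s) \<le> (x - t) \<bullet> (x - t) \<longleftrightarrow> 0 \<le> (x - z) \<bullet> (s - t)"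
    by (simp add: inner_diff_left inner_diff_right inner_commute) argo
  then show ?thesis
    by (simp add: norm_le)
qed

lemma convex_voronoi_cell: "convex (voronoi_cell T S)"
proof -
  have half: "convex {x. norm (x - s) \<le> norm (x - t)}" for s t :: 'a
  proof -
    have "{x. norm (x - s) \<le> norm (x - t)} = {x. (2 *\<^sub>R (t - s)) \<bullet> x \<le> t \<bullet> t - s \<bullet> s}"
      by (auto simp: norm_le inner_diff_left inner_diff_right inner_commute)
    then show ?thesis
      by (simp only: convex_halfspace_le)
  qed
  have "voronoi_cell T S = (\<Inter>s\<in>S. \<Inter>t\<in>T - S. {x. norm (x - s) \<le> norm (x - t)})"
    by (auto simp: mem_voronoi_cell_iff)
  then show ?thesis
    using half by (simp add: convex_INT)
qed

text \<open>Points of \<open>T\<close> at distance more than \<open>r + 2\<close> from \<open>z\<close> are farther than all of \<open>S\<close> from any \<open>x\<close>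
  with \<open>dist x z < 1\<close>. Among the finitely many remaining pairs, those that are not equidistant from
  \<open>z\<close> keep a strict inequality near \<open>z\<close>.\<close>

lemma voronoi_cell_near_centre:
  fixes S T :: "'a::euclidean_space set"
  assumes T: "discrete_set T" and S: "finite S" "S \<subseteq> cball z r"
    and out: "(T - S) \<inter> ball z r = {}"
  obtains e where "0 < e"
    and "\<And>x. \<lbrakk>x \<in> ball z e;
        \<And>s t. \<lbrakk>s \<in> S \<inter> sphere z r; t \<in> (T - S) \<inter> sphere z r\<rbrakk> \<Longrightarrow> 0 \<le> (x - z) \<bullet> (s - t)\<rbrakk>
      \<Longrightarrow> x \<in> voronoi_cell T S"
proof -
  define T1 where "T1 = T \<inter> cball z (r + 2)"
  have "finite T1"
    using T by (simp add: T1_def discrete_set_def)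
  have le: "dist z s \<le> r" "r \<le> dist z t" if "s \<in> S" "t \<in> T - S" for s t
    using that S(2) out by (auto simp: disjoint_iff not_less)
  have "\<forall>\<^sub>F x in nhds z. \<forall>(s, t)\<in>S \<times> T1. dist z s < dist z t \<longrightarrow> dist x s < dist x t"
  proof (intro eventually_ball_finite ballI)
    fix p assume "p \<in> S \<times> T1"
    obtain s t where p: "p = (s, t)"
      by (cases p)
    have "open {x. dist x s < dist x t}"
      by (intro open_Collect_less continuous_intros)
    then have "\<forall>\<^sub>F x in nhds z. x \<in> {x. dist x s < dist x t}" if "dist z s < dist z t"
      using that by (intro eventually_nhds_in_open) auto
    then show "\<forall>\<^sub>F x in nhds z. case p of (s, t) \<Rightarrow> dist z s < dist z t \<longrightarrow> dist x s < dist x t"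
      by (cases "dist z s < dist z t") (auto simp: p)
  qed (use S(1) \<open>finite T1\<close> in auto)
  then obtain d where d: "0 < d"
    "\<And>x s t. \<lbrakk>dist x z < d; s \<in> S; t \<in> T1; dist z s < dist z t\<rbrakk> \<Longrightarrow> dist x s < dist x t"
    by (auto simp: eventually_nhds_metric)
  show ?thesis
  proof (rule that[of "min d 1"])
    show "0 < min d 1"
      using d(1) by simp
  next
    fix x
    assume x: "x \<in> ball z (min d 1)"
      and cone: "\<And>s t. \<lbrakk>s \<in> S \<inter> sphere z r; t \<in> (T - S) \<inter> sphere z r\<rbrakk> \<Longrightarrow> 0 \<le> (x - z) \<bullet> (s - t)"
    have xz: "dist x z < d" "dist x z < 1"
      using x by (auto simp: dist_commute)
    have "norm (x - s) \<le> norm (x - t)" if st: "s \<in> S" "t \<in> T - S" for s t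
    proof (cases "dist z s < dist z t")
      case True
      show ?thesis
      proof (cases "t \<in> T1")
        case True
        then show ?thesis
          using d(2)[OF xz(1) st(1) True \<open>dist z s < dist z t\<close>] by (simp add: dist_norm)
      next
        case False
        then have "r + 2 < dist z t"
          using st by (auto simp: T1_def)
        moreover have "dist z t \<le> dist x z + dist x t" "dist x s \<le> dist x z + dist z s"
          by (metis dist_commute dist_triangle)+
        ultimately have "dist x s \<le> dist x t"
          using xz(2) le[OF st] by linarith
        then show ?thesis
          by (simp add: dist_norm)
      qed
    next
      case False
      then have eq: "dist z s = r" "dist z t = r"
        using le[OF st] by auto
      then have "0 \<le> (x - z) \<bullet> (s - t)"
        using cone st by auto
      then show ?thesis
        using norm_le_iff_inner_of_equidistant[of z s t x] eq by simp
    qed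
    then show "x \<in> voronoi_cell T S"
      by (simp add: mem_voronoi_cell_iff)
  qed
qed

text \<open>The inequalities of the equidistant pairs hold throughout the cell and suffice near \<open>z\<close>, so the
  cell and the translated cone coincide in a ball around their common point \<open>z\<close>. A nonempty open
  piece of a convex set has the dimension of the whole set.\<close>

lemma aff_dim_voronoi_cell:
  fixes S T :: "'a::euclidean_space set"
  assumes "discrete_set T" "finite S" "S \<subseteq> cball z r" "(T - S) \<inter> ball z r = {}"
  shows "aff_dim (voronoi_cell T S) =
    aff_dim {u. \<forall>d\<in>(\<lambda>(s, t). s - t) ` ((S \<inter> sphere z r) \<times> ((T - S) \<inter> sphere z r)). 0 \<le> u \<bullet> d}"
    (is "_ = aff_dim ?K")
proof -
  obtain e where e: "0 < e"
    "\<And>x. \<lbrakk>x \<in> ball z e;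
        \<And>s t. \<lbrakk>s \<in> S \<inter> sphere z r; t \<in> (T - S) \<inter> sphere z r\<rbrakk> \<Longrightarrow> 0 \<le> (x - z) \<bullet> (s - t)\<rbrakk>
      \<Longrightarrow> x \<in> voronoi_cell T S"
    using voronoi_cell_near_centre[OF assms] by blast
  let ?V = "voronoi_cell T S" and ?zK = "(+) z ` ?K"
  have zK: "x \<in> ?zK \<longleftrightarrow>
      (\<forall>s\<in>S \<inter> sphere z r. \<forall>t\<in>(T - S) \<inter> sphere z r. 0 \<le> (x - z) \<bullet> (s - t))" for x
  proof -
    have "x \<in> ?zK \<longleftrightarrow> x - z \<in> ?K"
      by (metis (no_types, lifting) add_diff_cancel_left' add_diff_inverse image_iff diff_add_cancel add.commute)
    then show ?thesis
      by auto
  qed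
  have "?V \<subseteq> ?zK"
  proof
    fix x assume x: "x \<in> ?V"
    have "0 \<le> (x - z) \<bullet> (s - t)" if "s \<in> S \<inter> sphere z r" "t \<in> (T - S) \<inter> sphere z r" for s t
      using that x norm_le_iff_inner_of_equidistant[of z s t x] by (auto simp: mem_voronoi_cell_iff)
    then show "x \<in> ?zK"
      unfolding zK by blast
  qed
  moreover have "?zK \<inter> ball z e \<subseteq> ?V"
  proof
    fix x assume x: "x \<in> ?zK \<inter> ball z e"
    then have "x \<in> ?zK"
      by (rule IntD1)
    then have "0 \<le> (x - z) \<bullet> (s - t)" if "s \<in> S \<inter> sphere z r" "t \<in> (T - S) \<inter> sphere z r" for s t
      using that unfolding zK by blast
    then show "x \<in> ?V"
      using e(2) x by blast
  qed
  ultimately have eq: "?V \<inter> ball z e = ?zK \<inter> ball z e"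
    by blast
  have "convex ?K"
    by (rule convexI) (auto simp: inner_add_left)
  then have "convex ?zK"
    by (rule convex_translation)
  have "z \<in> ?zK"
    unfolding zK by simp
  moreover have "z \<in> ball z e"
    using e(1) by simp
  ultimately have "z \<in> ?zK \<inter> ball z e"
    by (rule IntI)
  then have ne: "?zK \<inter> ball z e \<noteq> {}" "?V \<inter> ball z e \<noteq> {}"
    unfolding eq by blast+
  have "aff_dim ?V = aff_dim (?V \<inter> ball z e)"
    by (rule aff_dim_convex_Int_open[OF convex_voronoi_cell open_ball ne(2), symmetric])
  also have "\<dots> = aff_dim ?zK"
    unfolding eq by (rule aff_dim_convex_Int_open[OF \<open>convex ?zK\<close> open_ball ne(1)])
  also have "\<dots> = aff_dim ?K"
    by (rule aff_dim_translation_eq)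
  finally show ?thesis .
qed

section \<open>The dimension of the Voronoi cell\<close>

theorem theorem3p1:
  fixes S T B :: "(real ^ 'n) set" and z :: "real ^ 'n" and r :: real
  assumes "discrete_set T"
    and "finite S"
    and "B = cball z r" and "0 \<le> r"
    and "S \<subseteq> B"
    and "(T - S) \<inter> interior B = {}"
  shows
    "let P_S = convex hull (S \<inter> frontier B);
         P_T = convex hull ((T - S) \<inter> frontier B);
         C = P_S \<inter> P_T;
         F_S = minimal_face P_S C;
         F_T = minimal_face P_T C
     in aff_dim (voronoi_cell T S) =
          (if C = {} then int CARD('n)
           else int CARD('n) - aff_dim (convex hull (F_S \<union> F_T)))"
proof -
  define X where "X = S \<inter> sphere z r"
  define Y where "Y = (T - S) \<inter> sphere z r"
  define C where "C = convex hull X \<inter> convex hull Y"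
  define FX where "FX = minimal_face (convex hull X) C"
  define FY where "FY = minimal_face (convex hull Y) C"
  define D where "D = (\<lambda>(s, t). s - t) ` (X \<times> Y)"
  \<comment> \<open>The implicit equalities among the inequalities \<open>v \<bullet> d \<ge> 0\<close>.\<close>
  define E where "E = (if C = {} then {} else (\<lambda>(s, t). s - t) ` ((X \<inter> FX) \<times> (Y \<inter> FY)))"
  have fin: "finite X" "finite Y"
  proof -
    show "finite X"
      using assms(2) by (simp add: X_def)
    have "finite (T \<inter> sphere z r)"
      using assms(1) by (simp add: discrete_set_def)
    then show "finite Y"
      by (rule finite_subset[rotated]) (auto simp: Y_def)
  qed
  obtain u where u: "\<And>a b. \<lbrakk>a \<in> X; b \<in> Y\<rbrakk> \<Longrightarrow> u \<bullet> b \<le> u \<bullet> a"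
    "\<And>a b. \<lbrakk>a \<in> X; b \<in> Y; u \<bullet> a = u \<bullet> b\<rbrakk> \<Longrightarrow> C \<noteq> {} \<and> a \<in> FX \<and> b \<in> FY"
    using hulls_separating_functional[OF fin] unfolding C_def FX_def FY_def by blast
  have "aff_dim (voronoi_cell T S) = aff_dim {v. \<forall>d\<in>D. 0 \<le> v \<bullet> d}"
    unfolding D_def X_def Y_def using assms by (intro aff_dim_voronoi_cell) auto
  also have "\<dots> = int DIM(real ^ 'n) - int (dim E)"
  proof (rule aff_dim_polyhedral_cone)
    show "finite D"
      using fin by (simp add: D_def)
    show "E \<subseteq> D"
      by (auto simp: D_def E_def)
    show "v \<bullet> d = 0" if v: "\<forall>d\<in>D. 0 \<le> v \<bullet> d" and "d \<in> E" for v d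
    proof -
      have "C \<noteq> {}"
        using \<open>d \<in> E\<close> by (auto simp: E_def)
      then obtain f g where "d = f - g" "f \<in> FX" "g \<in> FY"
        using \<open>d \<in> E\<close> by (auto simp: E_def)
      moreover have "v \<bullet> b \<le> v \<bullet> a" if "a \<in> X" "b \<in> Y" for a b
        using v that by (force simp: D_def inner_diff_right)
      ultimately show ?thesis
        using separating_functional_constant_on_minimal_faces[of X Y v f g] \<open>C \<noteq> {}\<close>
        by (simp add: C_def FX_def FY_def inner_diff_right)
    qed
    show "0 \<le> u \<bullet> d" if "d \<in> D" for d
      using that u(1) by (auto simp: D_def inner_diff_right)
    show "0 < u \<bullet> d" if d: "d \<in> D - E" for d
    proof -
      obtain a b where ab: "a \<in> X" "b \<in> Y" "d = a - b"
        using d by (auto simp: D_def)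
      have "u \<bullet> a \<noteq> u \<bullet> b"
        using u(2)[OF ab(1,2)] d ab by (auto simp: E_def)
      then show ?thesis
        using u(1)[OF ab(1,2)] ab(3) by (simp add: inner_diff_right)
    qed
  qed
  also have "int (dim E) = (if C = {} then 0 else aff_dim (convex hull (FX \<union> FY)))"
  proof (cases "C = {}")
    case False
    have "FX face_of convex hull X" "FY face_of convex hull Y"
      unfolding FX_def FY_def by (auto intro!: minimal_face_face_of simp: C_def)
    then have hulls: "FX = convex hull (X \<inter> FX)" "FY = convex hull (Y \<inter> FY)"
      using face_of_finite_convex_hull fin by blast+
    have "FX \<noteq> {}" "FY \<noteq> {}"
      using False subset_minimal_face[of C] unfolding FX_def FY_def by blast+
    then have "X \<inter> FX \<noteq> {}" "Y \<inter> FY \<noteq> {}"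
      using hulls by (metis convex_hull_empty)+
    then have "int (dim E) = aff_dim ((X \<inter> FX) \<union> (Y \<inter> FY))"
      using False aff_dim_Un_eq_dim_differences[of "X \<inter> FX" "Y \<inter> FY"] by (simp add: E_def)
    also have "\<dots> = aff_dim (convex hull ((X \<inter> FX) \<union> (Y \<inter> FY)))"
      by (simp add: aff_dim_convex_hull)
    also have "convex hull ((X \<inter> FX) \<union> (Y \<inter> FY)) = convex hull (FX \<union> FY)"
      using hulls by (metis hull_Un_left hull_Un_right)
    finally show ?thesis
      using False by simp
  qed (simp add: E_def)
  finally show ?thesis
    using assms(3) by (simp add: Let_def C_def FX_def FY_def X_def Y_def)
qed

end
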